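(* Let $H$ be an adjacency $k$-resolved graph of order $n_2$ and let $G$ be a non-trivial graph of diameter $D(G)<k$. Then $\dim_l(G\boxtimes H)\le n_2\cdot \dim_l(G)$.
   Context: All graphs are finite, simple and connected; $d_G$ is the shortest-path distance and $D(G)$ the diameter. A set $S\subseteq V(G)$ is a local metric generator for $G$ if for every two adjacent vertices $x,y$ there is $s\in S$ with $d_G(s,x)\ne d_G(s,y)$; $\dim_l(G)$ is the minimum cardinality of a local metric generator. The strong product $G\boxtimes H$ has vertex set $V(G)\times V(H)$, with $(a,b)\sim(c,d)$ iff ($a=c$ and $b\sim d$) or ($b=d$ and $a\sim c$) or ($a\sim c$ and $b\sim d$). For $x,y\in V(G)$, the interval $I[x,y]$ is the set of vertices lying on some shortest $x$–$y$ path. For a nonnegative integer $k$, a graph $G$ is adjacency $k$-resolved if for every two adjacent vertices $x,y$ there is $w\in V(G)$ such that ($d_G(y,w)\ge k$ and $x\in I[y,w]$) or ($d_G(x,w)\ge k$ and $y\in I[x,w]$). *)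

theory Defs
  imports "Graph_Theory.Graph_Theory"
begin

text \<open>
  A finite simple graph is a \<^const>\<open>pair_graph\<close>: a finite loop-free digraph whose arcs are
  ordered pairs and form a symmetric relation, so each undirected edge is present as two
  opposite arcs.
\<close>

(* wf_digraph.\<mu> is the infimum of the costs of all walks; with unit costs this is the infimum
   of their lengths. It takes the value infinity between vertices in different components. *)
definition graph_dist :: "'a pair_pre_digraph \<Rightarrow> 'a \<Rightarrow> 'a \<Rightarrow> ereal" where
  "graph_dist G u v = wf_digraph.\<mu> (with_proj G) (\<lambda>_. 1) u v"

definition graph_diameter :: "'a pair_pre_digraph \<Rightarrow> ereal" where
  "graph_diameter G = (SUP u\<in>pverts G. SUP v\<in>pverts G. graph_dist G u v)"

definition graph_interval :: "'a pair_pre_digraph \<Rightarrow> 'a \<Rightarrow> 'a \<Rightarrow> 'a set" where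
  "graph_interval G x y =
     {v. \<exists>p. pre_digraph.apath (with_proj G) x p y \<and>
             ereal (real (length p)) = graph_dist G x y \<and>
             v \<in> set (pre_digraph.awalk_verts (with_proj G) x p)}"

definition local_metric_generator :: "'a pair_pre_digraph \<Rightarrow> 'a set \<Rightarrow> bool" where
  "local_metric_generator G S \<longleftrightarrow>
     S \<subseteq> pverts G \<and>
     (\<forall>x y. (x, y) \<in> parcs G \<longrightarrow> (\<exists>s\<in>S. graph_dist G s x \<noteq> graph_dist G s y))"

definition local_metric_dim :: "'a pair_pre_digraph \<Rightarrow> nat" where
  "local_metric_dim G = (LEAST n. \<exists>S. local_metric_generator G S \<and> card S = n)"

definition strong_prod ::
    "'a pair_pre_digraph \<Rightarrow> 'b pair_pre_digraph \<Rightarrow> ('a \<times> 'b) pair_pre_digraph" where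
  "strong_prod G H =
     \<lparr> pverts = pverts G \<times> pverts H,
       parcs = {((a, b), (c, d)) | a b c d.
          (a = c \<and> a \<in> pverts G \<and> (b, d) \<in> parcs H) \<or>
          (b = d \<and> b \<in> pverts H \<and> (a, c) \<in> parcs G) \<or>
          ((a, c) \<in> parcs G \<and> (b, d) \<in> parcs H)} \<rparr>"

definition adjacency_resolved :: "nat \<Rightarrow> 'a pair_pre_digraph \<Rightarrow> bool" where
  "adjacency_resolved k G \<longleftrightarrow>
     (\<forall>x y. (x, y) \<in> parcs G \<longrightarrow>
        (\<exists>w\<in>pverts G.
           (graph_dist G y w \<ge> ereal (real k) \<and> x \<in> graph_interval G y w) \<or>
           (graph_dist G x w \<ge> ereal (real k) \<and> y \<in> graph_interval G x w)))"

lemma pair_graph_strong_prod: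
  assumes "pair_graph G" "pair_graph H"
  shows "pair_graph (strong_prod G H)"
proof -
  interpret G: pair_graph G by fact
  interpret H: pair_graph H by fact
  have sub: "parcs (strong_prod G H) \<subseteq> (pverts G \<times> pverts H) \<times> (pverts G \<times> pverts H)"
    by (auto simp: strong_prod_def dest: G.in_arcsD1 G.in_arcsD2 H.in_arcsD1 H.in_arcsD2)
  have fin: "finite (pverts (strong_prod G H))"
    by (simp add: strong_prod_def G.pair_finite_verts H.pair_finite_verts)
  have "finite (parcs (strong_prod G H))"
    by (rule finite_subset[OF sub]) (simp add: G.pair_finite_verts H.pair_finite_verts)
  moreover have "symmetric (with_proj (strong_prod G H))"
    by (auto simp: symmetric_def sym_def strong_prod_def
             dest: G.arcs_symmetric H.arcs_symmetric)
  moreover have "fst e \<noteq> snd e" if "e \<in> parcs (strong_prod G H)" for e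
    using that by (auto simp: strong_prod_def dest: G.no_loops' H.no_loops')
  moreover have "fst e \<in> pverts (strong_prod G H)" "snd e \<in> pverts (strong_prod G H)"
    if "e \<in> parcs (strong_prod G H)" for e
    using that
    by (auto simp: strong_prod_def dest: G.in_arcsD1 G.in_arcsD2 H.in_arcsD1 H.in_arcsD2)
  ultimately show ?thesis
    using fin by unfold_locales auto
qed

end

theory Submission
  imports Defs
begin

text \<open>
  Distances in a strong product are the maxima of the distances in the factors, because a walk
  of length at most \<open>n\<close> in the product is a pair of such walks, each factor being allowed to stand
  still. If \<open>A\<close> is a local metric basis of \<open>G\<close>, then \<open>A \<times> V(H)\<close> is a local metric generator of the
  product. For an arc from \<open>(a,b)\<close> to \<open>(c,d)\<close> with \<open>a \<noteq> c\<close>, pick \<open>s \<in> A\<close> separating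
  \<open>a\<close> and \<open>c\<close>, and use \<open>(s,b)\<close> or \<open>(s,d)\<close>, so that the coordinate in \<open>H\<close> adds nothing to the larger
  of the two distances. For \<open>a = c\<close>, a witness \<open>w\<close> of adjacency resolution of \<open>b\<close> and \<open>d\<close> is, on one
  side, at distance at least \<open>k > D(G)\<close>, so that in \<open>(s,w)\<close> the coordinate in \<open>H\<close> decides.
\<close>

section \<open>Distance values: natural numbers or infinity\<close>

text \<open>With unit costs the infimum ranges over walk lengths. These are natural numbers, so it
  is attained as soon as some walk exists.\<close>

lemma graph_dist_cases:
  assumes "pair_wf_digraph G"
  obtains (infinite) "graph_dist G u v = \<infinity>"
  | (finite) n where "graph_dist G u v = ereal (real n)"
proof -
  interpret pair_wf_digraph G by fact
  have dist_INF: "graph_dist G u v = (INF p\<in>{p. awalk u p v}. ereal (real (length p)))"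
    by (simp add: graph_dist_def \<mu>_def awalk_cost_def sum_list_triv)
  show ?thesis
  proof (cases "\<exists>p. awalk u p v")
    case False
    then have "graph_dist G u v = \<infinity>"
      unfolding graph_dist_def by (intro shortest_path_inf) (simp add: reachable_awalk)
    then show ?thesis by (rule infinite)
  next
    case True
    then obtain p where p: "awalk u p v" "\<And>q. awalk u q v \<Longrightarrow> length p \<le> length q"
      using exists_least_iff[of "\<lambda>n. \<exists>p. awalk u p v \<and> length p = n"]
      by (metis linorder_not_less)
    have "graph_dist G u v = ereal (real (length p))"
      unfolding dist_INF using p by (intro INF_eqI) auto
    then show ?thesis by (rule finite)
  qed
qed

lemma graph_dist_nat_or_infinity:
  assumes "pair_wf_digraph G"
  shows "graph_dist G u v = \<infinity> \<or> (\<exists>n::nat. graph_dist G u v = ereal (real n))"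
  using assms by (rule graph_dist_cases[of G u v]) auto

lemma graph_dist_le_length:
  assumes "pair_wf_digraph G" "pre_digraph.awalk (with_proj G) u p v"
  shows "graph_dist G u v \<le> ereal (real (length p))"
proof -
  interpret pair_wf_digraph G by fact
  show ?thesis
    using min_cost_le_walk_cost[OF assms(2), of "\<lambda>_. 1"]
    by (simp add: graph_dist_def awalk_cost_def sum_list_triv)
qed

section \<open>Distance bounds as powers of the reflexive arc relation\<close>

lemma relpow_Suc_iff: "(u, w) \<in> R ^^ Suc n \<longleftrightarrow> (\<exists>v. (u, v) \<in> R \<and> (v, w) \<in> R ^^ n)"
  by (metis relpow_Suc_E2 relpow_Suc_I2)

lemma sym_relpow:
  assumes "sym R"
  shows "sym (R ^^ n)"
proof -
  have "(v, u) \<in> R ^^ n" if "(u, v) \<in> R ^^ n" for u v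
    using that
  proof (induction n arbitrary: u)
    case (Suc n)
    then obtain w where "(u, w) \<in> R" "(w, v) \<in> R ^^ n" by (auto simp only: relpow_Suc_iff)
    then show ?case using Suc.IH symD[OF assms] by (blast intro: relpow_Suc_I)
  qed simp
  then show ?thesis by (intro symI)
qed

text \<open>The reflexive closure allows a step that stands still, so the \<open>n\<close>-th power
  captures walks of length at most \<open>n\<close> rather than exactly \<open>n\<close>. This is
  what lets walks in two factors be synchronised later.\<close>

lemma relpow_refl_iff_awalk:
  assumes "pair_wf_digraph G" "u \<in> pverts G"
  shows "(u, v) \<in> ((parcs G)\<^sup>=) ^^ n \<longleftrightarrow>
    (\<exists>p. pre_digraph.awalk (with_proj G) u p v \<and> length p \<le> n)"
proof -
  interpret pair_wf_digraph G by fact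
  show ?thesis
    using assms(2)
  proof (induction n arbitrary: u)
    case 0
    then show ?case by (auto simp: awalk_Nil_iff)
  next
    case (Suc n)
    have "(u, v) \<in> ((parcs G)\<^sup>=) ^^ Suc n \<longleftrightarrow>
      (\<exists>w. (u, w) \<in> (parcs G)\<^sup>= \<and> (w, v) \<in> ((parcs G)\<^sup>=) ^^ n)"
      by (rule relpow_Suc_iff)
    also have "\<dots> \<longleftrightarrow> (\<exists>w p. (u, w) \<in> (parcs G)\<^sup>= \<and> awalk w p v \<and> length p \<le> n)"
    proof -
      have "w \<in> pverts G" if "(u, w) \<in> (parcs G)\<^sup>=" for w
        using that Suc.prems by (auto dest: in_arcsD2)
      then show ?thesis using Suc.IH by blast
    qed
    also have "\<dots> \<longleftrightarrow> (\<exists>p. awalk u p v \<and> length p \<le> Suc n)"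
    proof
      assume "\<exists>w p. (u, w) \<in> (parcs G)\<^sup>= \<and> awalk w p v \<and> length p \<le> n"
      then obtain w p where wp: "(u, w) \<in> (parcs G)\<^sup>=" "awalk w p v" "length p \<le> n" by blast
      show "\<exists>p. awalk u p v \<and> length p \<le> Suc n"
      proof (cases "u = w")
        case True
        then show ?thesis using wp le_SucI by blast
      next
        case False
        then have "awalk u ((u, w) # p) v" using wp by (auto simp: awalk_Cons_iff)
        then show ?thesis using wp(3) by (intro exI[of _ "(u, w) # p"]) simp
      qed
    next
      assume "\<exists>p. awalk u p v \<and> length p \<le> Suc n"
      then obtain p where p: "awalk u p v" "length p \<le> Suc n" by blast
      show "\<exists>w p. (u, w) \<in> (parcs G)\<^sup>= \<and> awalk w p v \<and> length p \<le> n"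
      proof (cases p)
        case Nil
        then show ?thesis using p by (intro exI[of _ u] exI[of _ "[]"]) auto
      next
        case (Cons e es)
        then show ?thesis using p
          by (intro exI[of _ "snd e"] exI[of _ es]) (auto simp: awalk_Cons_iff)
      qed
    qed
    finally show ?case .
  qed
qed

lemma graph_dist_le_iff:
  assumes "pair_wf_digraph G" "u \<in> pverts G"
  shows "graph_dist G u v \<le> ereal (real n) \<longleftrightarrow> (u, v) \<in> ((parcs G)\<^sup>=) ^^ n"
proof
  interpret pair_wf_digraph G by fact
  assume "graph_dist G u v \<le> ereal (real n)"
  \<comment> \<open>A strict bound on an infimum yields a walk below that bound; a weak one need
    not. Integrality of the length then turns \<open>< Suc n\<close> back into
    \<open>\<le> n\<close>.\<close>
  then have "graph_dist G u v < ereal (real (Suc n))"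
    by (rule order_le_less_trans) simp
  then obtain p where "awalk u p v" "length p < Suc n"
    by (auto simp: graph_dist_def \<mu>_def awalk_cost_def sum_list_triv INF_less_iff simp del: of_nat_Suc)
  then show "(u, v) \<in> ((parcs G)\<^sup>=) ^^ n"
    using assms by (auto simp: relpow_refl_iff_awalk)
next
  assume "(u, v) \<in> ((parcs G)\<^sup>=) ^^ n"
  then obtain p where p: "pre_digraph.awalk (with_proj G) u p v" "length p \<le> n"
    using assms by (auto simp: relpow_refl_iff_awalk)
  have "graph_dist G u v \<le> ereal (real (length p))"
    using assms(1) p(1) by (rule graph_dist_le_length)
  also have "\<dots> \<le> ereal (real n)" using p by simp
  finally show "graph_dist G u v \<le> ereal (real n)" .
qed

section \<open>Metric properties, intervals and the diameter\<close>

lemma graph_dist_nonneg: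
  assumes "pair_wf_digraph G"
  shows "0 \<le> graph_dist G u v"
  using assms by (rule graph_dist_cases[of G u v]) auto

lemma graph_dist_eq_0_iff:
  assumes "pair_wf_digraph G" "u \<in> pverts G"
  shows "graph_dist G u v = 0 \<longleftrightarrow> u = v"
proof -
  have "graph_dist G u v = 0 \<longleftrightarrow> graph_dist G u v \<le> ereal (real 0)"
    using graph_dist_nonneg[OF assms(1), of u v] by (auto simp: zero_ereal_def)
  then show ?thesis using graph_dist_le_iff[OF assms, of v 0] by simp
qed

lemma graph_dist_ge_1:
  assumes "pair_wf_digraph G" "u \<in> pverts G" "u \<noteq> v"
  shows "1 \<le> graph_dist G u v"
  using graph_dist_eq_0_iff[OF assms(1,2), of v] assms(3)
  by (cases rule: graph_dist_cases[OF assms(1), of u v]) auto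

lemma graph_dist_arc_le_1:
  assumes "pair_wf_digraph G" "(u, v) \<in> parcs G"
  shows "graph_dist G u v \<le> 1"
proof -
  interpret pair_wf_digraph G by fact
  show ?thesis
    using graph_dist_le_iff[OF assms(1) in_arcsD1[OF assms(2)], of v 1] assms(2)
    by (simp add: one_ereal_def)
qed

text \<open>Reduces an equation between distances to their natural upper bounds, which
  \<open>graph_dist_le_iff\<close> translates into relation powers.\<close>

lemma ereal_eqI_nat:
  fixes x y :: ereal
  assumes "x = \<infinity> \<or> (\<exists>m::nat. x = ereal (real m))" "y = \<infinity> \<or> (\<exists>m::nat. y = ereal (real m))"
    and "\<And>n::nat. x \<le> ereal (real n) \<longleftrightarrow> y \<le> ereal (real n)"
  shows "x = y"
  using assms(1,2)
proof (elim disjE exE)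
  fix m n :: nat
  assume "x = ereal (real m)" "y = ereal (real n)"
  then show ?thesis using assms(3)[of m] assms(3)[of n] by simp
next
  fix m :: nat
  assume "x = \<infinity>" "y = ereal (real m)"
  then show ?thesis using assms(3)[of m] by simp
next
  fix m :: nat
  assume "x = ereal (real m)" "y = \<infinity>"
  then show ?thesis using assms(3)[of m] by simp
qed simp

lemma graph_dist_commute:
  assumes "pair_graph G" "u \<in> pverts G" "v \<in> pverts G"
  shows "graph_dist G u v = graph_dist G v u"
proof -
  interpret pair_graph G by fact
  have wf: "pair_wf_digraph G" by unfold_locales
  have "sym ((parcs G)\<^sup>=)" using arcs_symmetric by (auto intro!: symI)
  then have sym: "sym (((parcs G)\<^sup>=) ^^ n)" for n
    by (rule sym_relpow)
  show ?thesis
  proof (rule ereal_eqI_nat)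
    fix n
    show "graph_dist G u v \<le> ereal (real n) \<longleftrightarrow> graph_dist G v u \<le> ereal (real n)"
      using sym[of n] by (auto simp: graph_dist_le_iff wf assms dest: symD)
  qed (simp_all add: graph_dist_nat_or_infinity wf)
qed

text \<open>Cutting a shortest path from \<open>x\<close> to \<open>y\<close> at \<open>v\<close>
  leaves a walk from \<open>v\<close> to \<open>y\<close> that is strictly shorter, because the part
  cut off is nonempty.\<close>

lemma graph_dist_interval_less:
  assumes "pair_graph G" "v \<in> graph_interval G x y" "v \<noteq> x"
  shows "graph_dist G v y < graph_dist G x y"
proof -
  interpret pair_graph G by fact
  have wf: "pair_wf_digraph G" by unfold_locales
  obtain p where p: "awalk x p y" "ereal (real (length p)) = graph_dist G x y"
    "v \<in> set (pawalk_verts x p)"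
    using assms(2) by (auto simp: graph_interval_def apath_def)
  obtain q r where qr: "p = q @ r" "awalk x q v" "awalk v r y"
    using awalk_decomp[OF p(1,3)] by blast
  have "q \<noteq> []" using qr(2) assms(3) by (auto simp: awalk_Nil_iff)
  have "graph_dist G v y \<le> ereal (real (length r))"
    using wf qr(3) by (rule graph_dist_le_length)
  also have "\<dots> < ereal (real (length p))" using qr(1) \<open>q \<noteq> []\<close> by simp
  finally show ?thesis using p(2) by simp
qed

lemma graph_dist_le_diameter:
  assumes "u \<in> pverts G" "v \<in> pverts G"
  shows "graph_dist G u v \<le> graph_diameter G"
  unfolding graph_diameter_def using assms by (intro SUP_upper2[of u] SUP_upper) auto

section \<open>Distances in the strong product\<close>

text \<open>On vertices, the reflexive closure of the product arcs is the componentwise product of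
  the two reflexive closures, and powers inherit this.\<close>

lemma strong_prod_relpow:
  assumes "pair_wf_digraph G" "pair_wf_digraph H" "a \<in> pverts G" "b \<in> pverts H"
  shows "((a, b), (c, d)) \<in> ((parcs (strong_prod G H))\<^sup>=) ^^ n \<longleftrightarrow>
    (a, c) \<in> ((parcs G)\<^sup>=) ^^ n \<and> (b, d) \<in> ((parcs H)\<^sup>=) ^^ n"
  using assms(3,4)
proof (induction n arbitrary: a b)
  case (Suc n)
  interpret G: pair_wf_digraph G by fact
  interpret H: pair_wf_digraph H by fact
  have step: "((a, b), (x, y)) \<in> (parcs (strong_prod G H))\<^sup>= \<longleftrightarrow>
      (a, x) \<in> (parcs G)\<^sup>= \<and> (b, y) \<in> (parcs H)\<^sup>=" for x y
    using Suc.prems by (auto simp: strong_prod_def)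
  \<comment> \<open>The induction hypothesis speaks of vertices only, so the intermediate pair must
    stay inside the vertex sets.\<close>
  have closed: "x \<in> pverts G" "y \<in> pverts H"
    if "(a, x) \<in> (parcs G)\<^sup>=" "(b, y) \<in> (parcs H)\<^sup>=" for x y
    using that Suc.prems by (auto dest: G.in_arcsD2 H.in_arcsD2)
  have "((a, b), (c, d)) \<in> ((parcs (strong_prod G H))\<^sup>=) ^^ Suc n \<longleftrightarrow>
    (\<exists>x y. ((a, b), (x, y)) \<in> (parcs (strong_prod G H))\<^sup>= \<and>
       ((x, y), (c, d)) \<in> ((parcs (strong_prod G H))\<^sup>=) ^^ n)"
    unfolding relpow_Suc_iff by (simp only: split_paired_Ex)
  also have "\<dots> \<longleftrightarrow> (\<exists>x y. ((a, x) \<in> (parcs G)\<^sup>= \<and> (b, y) \<in> (parcs H)\<^sup>=) \<and>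
       (x, c) \<in> ((parcs G)\<^sup>=) ^^ n \<and> (y, d) \<in> ((parcs H)\<^sup>=) ^^ n)"
    unfolding step using Suc.IH closed by (intro ex_cong1 conj_cong refl) blast
  also have "\<dots> \<longleftrightarrow> (a, c) \<in> ((parcs G)\<^sup>=) ^^ Suc n \<and> (b, d) \<in> ((parcs H)\<^sup>=) ^^ Suc n"
    unfolding relpow_Suc_iff by blast
  finally show ?case .
qed auto

lemma graph_dist_strong_prod:
  assumes "pair_graph G" "pair_graph H" "a \<in> pverts G" "b \<in> pverts H"
  shows "graph_dist (strong_prod G H) (a, b) (c, d) = max (graph_dist G a c) (graph_dist H b d)"
proof -
  have wf: "pair_wf_digraph G" "pair_wf_digraph H" "pair_wf_digraph (strong_prod G H)"
    using pair_graph_strong_prod[OF assms(1,2)] assms(1,2)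
    by (auto simp: pair_graph_def pair_digraph_def pair_fin_digraph_def)
  have ab: "(a, b) \<in> pverts (strong_prod G H)" using assms by (simp add: strong_prod_def)
  show ?thesis
  proof (rule ereal_eqI_nat)
    show "max (graph_dist G a c) (graph_dist H b d) = \<infinity> \<or>
      (\<exists>m::nat. max (graph_dist G a c) (graph_dist H b d) = ereal (real m))"
      using graph_dist_nat_or_infinity[OF wf(1), of a c] graph_dist_nat_or_infinity[OF wf(2), of b d]
      by (auto simp: max_def)
    show "graph_dist (strong_prod G H) (a, b) (c, d) \<le> ereal (real n) \<longleftrightarrow>
      max (graph_dist G a c) (graph_dist H b d) \<le> ereal (real n)" for n
      using assms by (simp add: graph_dist_le_iff wf ab strong_prod_relpow)
  qed (rule graph_dist_nat_or_infinity[OF wf(3)])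
qed

section \<open>Local metric bases\<close>

text \<open>The set of all vertices is a generator, since each endpoint of an arc separates itself
  from the other one. Hence the minimum in \<open>local_metric_dim\<close> is attained.\<close>

lemma local_metric_basis_exists:
  assumes "pair_graph G"
  obtains S where "local_metric_generator G S" "card S = local_metric_dim G"
proof -
  interpret pair_graph G by fact
  have wf: "pair_wf_digraph G" by unfold_locales
  have "local_metric_generator G (pverts G)"
    unfolding local_metric_generator_def
  proof (intro conjI allI impI)
    fix x y assume "(x, y) \<in> parcs G"
    then have "x \<in> pverts G" "x \<noteq> y" by (auto dest: in_arcsD1 no_loops')
    then have "graph_dist G x x \<noteq> graph_dist G x y"
      using graph_dist_eq_0_iff[OF wf \<open>x \<in> pverts G\<close>] by metis
    then show "\<exists>s\<in>pverts G. graph_dist G s x \<noteq> graph_dist G s y"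
      using \<open>x \<in> pverts G\<close> by blast
  qed simp
  then have "\<exists>n S. local_metric_generator G S \<and> card S = n" by blast
  then have "\<exists>S. local_metric_generator G S \<and> card S = local_metric_dim G"
    unfolding local_metric_dim_def by (rule LeastI_ex)
  then show ?thesis using that by blast
qed

text \<open>Excludes an empty basis: the empty set is a generator exactly when there are no arcs.
  The arc is the first step of a walk between two distinct vertices.\<close>

lemma nontrivial_connected_has_arc:
  assumes "pair_graph G" "Digraph_Component.connected (with_proj G)" "card (pverts G) \<ge> 2"
  obtains x y where "(x, y) \<in> parcs G"
proof -
  interpret pair_graph G by fact
  have "\<not> card (pverts G) \<le> 1" using assms(3) by simp
  then obtain u v where uv: "u \<in> pverts G" "v \<in> pverts G" "u \<noteq> v"
    using card_le_Suc0_iff_eq[OF pair_finite_verts] by auto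
  have "strongly_connected (with_proj G)"
    using assms(2) by (intro symmetric_connected_imp_strongly_connected pair_sym_arcs)
  then have "u \<rightarrow>\<^sup>*\<^bsub>with_proj G\<^esub> v" using uv by (auto elim: strongly_connectedE)
  then obtain p where "awalk u p v" by (auto simp: reachable_awalk)
  then show ?thesis
    using uv(3) that by (cases p) (auto simp: awalk_Nil_iff awalk_Cons_iff)
qed

section \<open>The generator of the product and the bound\<close>

lemma local_metric_generator_strong_prod:
  assumes G: "pair_graph G" and H: "pair_graph H"
    and res: "adjacency_resolved k H" and diam: "graph_diameter G < ereal (real k)"
    and A: "local_metric_generator G A" "A \<noteq> {}"
  shows "local_metric_generator (strong_prod G H) (A \<times> pverts H)"
proof -
  interpret G: pair_graph G by fact
  interpret H: pair_graph H by fact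
  have wf: "pair_wf_digraph G" "pair_wf_digraph H" by unfold_locales
  have AV: "A \<subseteq> pverts G" using A by (simp add: local_metric_generator_def)
  note prod = graph_dist_strong_prod[OF G H]
  have self: "graph_dist H b b = 0" if "b \<in> pverts H" for b
    using graph_dist_eq_0_iff[OF wf(2) that] by simp
  have diff: "\<exists>s\<in>A \<times> pverts H.
      graph_dist (strong_prod G H) s (a, b) \<noteq> graph_dist (strong_prod G H) s (c, d)"
    if ac: "(a, c) \<in> parcs G" and bd: "b = d \<or> (b, d) \<in> parcs H"
      and V: "b \<in> pverts H" "d \<in> pverts H" for a b c d
  proof -
    obtain s where s: "s \<in> A" "graph_dist G s a \<noteq> graph_dist G s c"
      using A(1) ac unfolding local_metric_generator_def by blast
    have sV: "s \<in> pverts G" using s AV by blast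
    have nonneg: "0 \<le> graph_dist G s x" for x
      by (rule graph_dist_nonneg[OF wf(1)])
    have le1: "graph_dist H b d \<le> 1" "graph_dist H d b \<le> 1"
      using bd V graph_dist_arc_le_1[OF wf(2)] H.arcs_symmetric[of b d] self by auto
    \<comment> \<open>The larger of two distances is nonzero, hence at least 1, and so it dominates
      the \<open>H\<close> coordinate bounded in \<open>le1\<close>.\<close>
    have ge1: "1 \<le> graph_dist G s x" if "graph_dist G s y < graph_dist G s x" for x y
    proof -
      have "s \<noteq> x" using that nonneg[of y] graph_dist_eq_0_iff[OF wf(1) sV, of x] by auto
      then show ?thesis by (rule graph_dist_ge_1[OF wf(1) sV])
    qed
    consider "graph_dist G s a < graph_dist G s c" | "graph_dist G s c < graph_dist G s a"
      using s(2) by (meson linorder_neqE)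
    then show ?thesis
    proof cases
      case 1
      \<comment> \<open>The two distances are exactly those from \<open>s\<close> to
        \<open>a\<close> and to \<open>c\<close>: the \<open>H\<close> coordinate contributes 0 at
        \<open>(a, b)\<close>, and at most 1 at \<open>(c, d)\<close>, the side with the larger
        distance.\<close>
      then have "graph_dist (strong_prod G H) (s, b) (a, b) \<noteq> graph_dist (strong_prod G H) (s, b) (c, d)"
        using ge1[OF 1] le1(1) nonneg[of a] by (simp add: prod sV V self max_absorb1 order_trans[of _ 1])
      then show ?thesis using s(1) V by blast
    next
      case 2
      \<comment> \<open>Now \<open>a\<close> is the farther vertex, so the contribution 0 is needed
        at \<open>(c, d)\<close>, which \<open>(s, d)\<close> provides.\<close>
      then have "graph_dist (strong_prod G H) (s, d) (a, b) \<noteq> graph_dist (strong_prod G H) (s, d) (c, d)"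
        using ge1[OF 2] le1(2) nonneg[of c] by (simp add: prod sV V self max_absorb1 order_trans[of _ 1])
      then show ?thesis using s(1) V by blast
    qed
  qed
  have same: "\<exists>s\<in>A \<times> pverts H.
      graph_dist (strong_prod G H) s (a, b) \<noteq> graph_dist (strong_prod G H) s (a, d)"
    if aV: "a \<in> pverts G" and bd: "(b, d) \<in> parcs H" for a b d
  proof -
    \<comment> \<open>The \<open>G\<close> coordinates agree, so any element of \<open>A\<close>
      will do.\<close>
    obtain s where s: "s \<in> A" using A(2) by blast
    then have sV: "s \<in> pverts G" using AV by blast
    have s_less: "graph_dist G s a < ereal (real k)"
      using graph_dist_le_diameter[OF sV aV] diam by (rule order_le_less_trans)
    \<comment> \<open>Resolution is restated with distances measured from \<open>w\<close>, the form
      a generator uses; membership in an interval becomes a strict inequality.\<close>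
    have "\<exists>w\<in>pverts H.
        (ereal (real k) \<le> graph_dist H w d \<and> graph_dist H w b < graph_dist H w d) \<or>
        (ereal (real k) \<le> graph_dist H w b \<and> graph_dist H w d < graph_dist H w b)"
    proof -
      have V: "b \<in> pverts H" "d \<in> pverts H" and ne: "b \<noteq> d"
        using bd by (auto dest: H.in_arcsD1 H.in_arcsD2 H.no_loops')
      obtain w where w: "w \<in> pverts H"
        "(ereal (real k) \<le> graph_dist H d w \<and> b \<in> graph_interval H d w) \<or>
         (ereal (real k) \<le> graph_dist H b w \<and> d \<in> graph_interval H b w)"
        using res bd unfolding adjacency_resolved_def by blast
      have "graph_dist H w b = graph_dist H b w" "graph_dist H w d = graph_dist H d w"
        using graph_dist_commute[OF H] w(1) V by auto
      then show ?thesis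
        using w ne graph_dist_interval_less[OF H, of b d w] graph_dist_interval_less[OF H, of d b w]
        by (intro bexI[of _ w]) auto
    qed
    then obtain w where w: "w \<in> pverts H" and
      "(ereal (real k) \<le> graph_dist H w d \<and> graph_dist H w b < graph_dist H w d) \<or>
       (ereal (real k) \<le> graph_dist H w b \<and> graph_dist H w d < graph_dist H w b)"
      by blast
    \<comment> \<open>The larger distance from \<open>w\<close> is at least \<open>k\<close>, hence
      exceeds the distance from \<open>s\<close> to \<open>a\<close> and equals its maximum; both
      terms of the other maximum are strictly smaller.\<close>
    then have "max (graph_dist G s a) (graph_dist H w b) \<noteq> max (graph_dist G s a) (graph_dist H w d)"
      using s_less by (auto simp: max_def)
    then have "graph_dist (strong_prod G H) (s, w) (a, b) \<noteq> graph_dist (strong_prod G H) (s, w) (a, d)"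
      using w by (simp add: prod sV)
    then show ?thesis using s w by blast
  qed
  show ?thesis
    unfolding local_metric_generator_def
  proof (intro conjI allI impI)
    show "A \<times> pverts H \<subseteq> pverts (strong_prod G H)"
      using AV by (auto simp: strong_prod_def)
    fix x y assume xy: "(x, y) \<in> parcs (strong_prod G H)"
    obtain a b c d where eq: "x = (a, b)" "y = (c, d)" by (metis surj_pair)
    \<comment> \<open>The two kinds of product arc that move in \<open>G\<close> are merged, as
      \<open>diff\<close> treats both.\<close>
    have "a = c \<and> a \<in> pverts G \<and> (b, d) \<in> parcs H \<or>
      (a, c) \<in> parcs G \<and> (b = d \<or> (b, d) \<in> parcs H) \<and> b \<in> pverts H \<and> d \<in> pverts H"
      using xy by (auto simp: strong_prod_def eq dest: H.in_arcsD1 H.in_arcsD2)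
    then show "\<exists>s\<in>A \<times> pverts H.
        graph_dist (strong_prod G H) s x \<noteq> graph_dist (strong_prod G H) s y"
      unfolding eq using diff same by blast
  qed
qed

theorem theorem5:
  fixes G :: "'a pair_pre_digraph" and H :: "'b pair_pre_digraph" and k n\<^sub>2 :: nat
  assumes "pair_graph G" and "Digraph_Component.connected (with_proj G)"
    and "pair_graph H" and "Digraph_Component.connected (with_proj H)"
    and "adjacency_resolved k H" and "card (pverts H) = n\<^sub>2"
    and "card (pverts G) \<ge> 2" and "graph_diameter G < ereal (real k)"
  shows "local_metric_dim (strong_prod G H) \<le> n\<^sub>2 * local_metric_dim G"
proof -
  obtain A where A: "local_metric_generator G A" "card A = local_metric_dim G"
    using assms(1) by (rule local_metric_basis_exists)
  have "A \<noteq> {}"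
    using nontrivial_connected_has_arc[OF assms(1,2,7)] A(1)
    by (metis empty_iff local_metric_generator_def)
  then have "local_metric_generator (strong_prod G H) (A \<times> pverts H)"
    using assms A(1) by (intro local_metric_generator_strong_prod)
  then have "local_metric_dim (strong_prod G H) \<le> card (A \<times> pverts H)"
    unfolding local_metric_dim_def by (intro Least_le) blast
  also have "\<dots> = n\<^sub>2 * local_metric_dim G"
    using A(2) assms(6) by (simp add: card_cartesian_product)
  finally show ?thesis .
qed

end
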